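(* Let $\mathcal{C}$ be a skeletally small extriangulated category with Grothendieck monoid $\mathsf{M}(\mathcal{C})$. Then there is a bijection between the following two sets: (1) the set of Serre subcategories of $\mathcal{C}$; (2) the set of faces of $\mathsf{M}(\mathcal{C})$. Here a face $F$ of a monoid $M$ is a submonoid of $M$ such that $a+b\in F$ if and only if both $a\in F$ and $b\in F$, for any $a,b\in M$.
   Context: An extriangulated category $\mathcal{C}=(\mathcal{C},\mathbb{E},\mathfrak{s})$ is meant in the sense of Nakaoka--Palu (an additive category with an additive bifunctor $\mathbb{E}\colon \mathcal{C}^{\mathrm{op}}\times\mathcal{C}\to \mathsf{Ab}$ and an additive realization $\mathfrak{s}$ satisfying their axioms). A conflation $X \to Y \to Z \dashrightarrow$ is a sequence realizing some $\delta\in\mathbb{E}(Z,X)$. Subcategories are full and closed under isomorphisms. A subcategory $\mathcal{S}$ is a Serre subcategory if it is additive (contains $0$ and is closed under finite direct sums) and, for every conflation $X\to Y\to Z\dashrightarrow$ in $\mathcal{C}$, one has $Y\in\mathcal{S}$ if and only if both $X\in\mathcal{S}$ and $Z\in\mathcal{S}$. All monoids are commutative, written additively with unit $0$. Let $\mathsf{Iso}\,\mathcal{C}$ be the set of isomorphism classes of objects. A map $f\colon \mathsf{Iso}\,\mathcal{C}\to M$ to a monoid respects conflations if $f[0]=0$ and $f[Y]=f[X]+f[Z]$ for every conflation $X\to Y\to Z\dashrightarrow$. The Grothendieck monoid $\mathsf{M}(\mathcal{C})$ is the monoid equipped with a map $\mathsf{Iso}\,\mathcal{C}\to\mathsf{M}(\mathcal{C})$,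 $X\mapsto[X]$, that is universal among maps to monoids respecting conflations. *)

theory Defs
  imports "HOL-Library.Multiset" "HOL-Algebra.Group"
begin

section \<open>Additive categories\<close>

text \<open>
  Abelian groups and commutative monoids are records of \<open>HOL-Algebra\<close>, whose operation is
  printed multiplicatively: on \<open>Hom\<close>, on \<open>Ext\<close> and on the Grothendieck monoid, \<open>\<otimes>\<close> is the addition
  of the mathematical text and \<open>\<one>\<close> its zero.  Hom-sets are not required to be disjoint; a category
  is put into this form by tagging each morphism with its domain and codomain.  Since
  \<open>Obj\<close> and all hom-sets are sets over a type, the isomorphism classes form a set: every such category
  is skeletally small, and every skeletally small category is equivalent to one of this form.
\<close>

record ('o, 'a) category_data =
  Obj :: "'o set"
  Hom :: "'o \<Rightarrow> 'o \<Rightarrow> 'a monoid"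
  Comp :: "'a \<Rightarrow> 'a \<Rightarrow> 'a" (infixl "\<cdot>\<index>" 70)
  Id :: "'o \<Rightarrow> 'a"

abbreviation Mor :: "('o, 'a, 'z) category_data_scheme \<Rightarrow> 'o \<Rightarrow> 'o \<Rightarrow> 'a set"
  where "Mor \<C> A B \<equiv> carrier (Hom \<C> A B)"

locale category =
  fixes \<C> :: "('o, 'a, 'z) category_data_scheme" (structure)
  assumes Id_Mor: "A \<in> Obj \<C> \<Longrightarrow> Id \<C> A \<in> Mor \<C> A A"
    and Comp_Mor: "\<lbrakk>A \<in> Obj \<C>; B \<in> Obj \<C>; D \<in> Obj \<C>; f \<in> Mor \<C> A B; g \<in> Mor \<C> B D\<rbrakk>
      \<Longrightarrow> g \<cdot> f \<in> Mor \<C> A D"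
    and Comp_Id: "\<lbrakk>A \<in> Obj \<C>; B \<in> Obj \<C>; f \<in> Mor \<C> A B\<rbrakk> \<Longrightarrow> f \<cdot> Id \<C> A = f"
    and Id_Comp: "\<lbrakk>A \<in> Obj \<C>; B \<in> Obj \<C>; f \<in> Mor \<C> A B\<rbrakk> \<Longrightarrow> Id \<C> B \<cdot> f = f"
    and Comp_assoc: "\<lbrakk>A \<in> Obj \<C>; B \<in> Obj \<C>; D \<in> Obj \<C>; E \<in> Obj \<C>;
        f \<in> Mor \<C> A B; g \<in> Mor \<C> B D; h \<in> Mor \<C> D E\<rbrakk>
      \<Longrightarrow> (h \<cdot> g) \<cdot> f = h \<cdot> (g \<cdot> f)"

definition is_isomorphism :: "('o, 'a, 'z) category_data_scheme \<Rightarrow> 'o \<Rightarrow> 'o \<Rightarrow> 'a \<Rightarrow> bool"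
  where "is_isomorphism \<C> A B f \<longleftrightarrow> f \<in> Mor \<C> A B \<and>
    (\<exists>g \<in> Mor \<C> B A. g \<cdot>\<^bsub>\<C>\<^esub> f = Id \<C> A \<and> f \<cdot>\<^bsub>\<C>\<^esub> g = Id \<C> B)"

definition iso_rel :: "('o, 'a, 'z) category_data_scheme \<Rightarrow> ('o \<times> 'o) set"
  where "iso_rel \<C> = {(A, B). A \<in> Obj \<C> \<and> B \<in> Obj \<C> \<and> (\<exists>f. is_isomorphism \<C> A B f)}"

abbreviation iso_class :: "('o, 'a, 'z) category_data_scheme \<Rightarrow> 'o \<Rightarrow> 'o set"
  where "iso_class \<C> A \<equiv> iso_rel \<C> `` {A}"

definition Iso :: "('o, 'a, 'z) category_data_scheme \<Rightarrow> 'o set set"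
  where "Iso \<C> = Obj \<C> // iso_rel \<C>"

definition is_zero_object :: "('o, 'a, 'z) category_data_scheme \<Rightarrow> 'o \<Rightarrow> bool"
  where "is_zero_object \<C> Z \<longleftrightarrow> Z \<in> Obj \<C> \<and>
    (\<forall>A \<in> Obj \<C>. (\<exists>!f. f \<in> Mor \<C> A Z) \<and> (\<exists>!f. f \<in> Mor \<C> Z A))"

record ('o, 'a) biproduct_data =
  apex :: 'o
  in1 :: 'a
  in2 :: 'a
  pr1 :: 'a
  pr2 :: 'a

definition is_biproduct ::
    "('o, 'a, 'z) category_data_scheme \<Rightarrow> 'o \<Rightarrow> 'o \<Rightarrow> ('o, 'a) biproduct_data \<Rightarrow> bool"
  where "is_biproduct \<C> A B P \<longleftrightarrow>
    A \<in> Obj \<C> \<and> B \<in> Obj \<C> \<and> apex P \<in> Obj \<C> \<and>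
    in1 P \<in> Mor \<C> A (apex P) \<and> in2 P \<in> Mor \<C> B (apex P) \<and>
    pr1 P \<in> Mor \<C> (apex P) A \<and> pr2 P \<in> Mor \<C> (apex P) B \<and>
    pr1 P \<cdot>\<^bsub>\<C>\<^esub> in1 P = Id \<C> A \<and> pr2 P \<cdot>\<^bsub>\<C>\<^esub> in2 P = Id \<C> B \<and>
    pr1 P \<cdot>\<^bsub>\<C>\<^esub> in2 P = \<one>\<^bsub>Hom \<C> B A\<^esub> \<and> pr2 P \<cdot>\<^bsub>\<C>\<^esub> in1 P = \<one>\<^bsub>Hom \<C> A B\<^esub> \<and>
    (in1 P \<cdot>\<^bsub>\<C>\<^esub> pr1 P) \<otimes>\<^bsub>Hom \<C> (apex P) (apex P)\<^esub> (in2 P \<cdot>\<^bsub>\<C>\<^esub> pr2 P) = Id \<C> (apex P)"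

text \<open>The morphism \<open>x \<oplus> x'\<close> with respect to chosen biproducts of the sources and of the targets.\<close>

definition mor_sum :: "('o, 'a, 'z) category_data_scheme \<Rightarrow>
    ('o, 'a) biproduct_data \<Rightarrow> ('o, 'a) biproduct_data \<Rightarrow> 'a \<Rightarrow> 'a \<Rightarrow> 'a"
  where "mor_sum \<C> P Q x x' =
    (in1 Q \<cdot>\<^bsub>\<C>\<^esub> (x \<cdot>\<^bsub>\<C>\<^esub> pr1 P)) \<otimes>\<^bsub>Hom \<C> (apex P) (apex Q)\<^esub> (in2 Q \<cdot>\<^bsub>\<C>\<^esub> (x' \<cdot>\<^bsub>\<C>\<^esub> pr2 P))"

locale additive_category = category +
  assumes Hom_group: "\<lbrakk>A \<in> Obj \<C>; B \<in> Obj \<C>\<rbrakk> \<Longrightarrow> comm_group (Hom \<C> A B)"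
    and Comp_add_left: "\<lbrakk>A \<in> Obj \<C>; B \<in> Obj \<C>; D \<in> Obj \<C>;
        f \<in> Mor \<C> A B; g \<in> Mor \<C> B D; g' \<in> Mor \<C> B D\<rbrakk>
      \<Longrightarrow> (g \<otimes>\<^bsub>Hom \<C> B D\<^esub> g') \<cdot> f = (g \<cdot> f) \<otimes>\<^bsub>Hom \<C> A D\<^esub> (g' \<cdot> f)"
    and Comp_add_right: "\<lbrakk>A \<in> Obj \<C>; B \<in> Obj \<C>; D \<in> Obj \<C>;
        f \<in> Mor \<C> A B; f' \<in> Mor \<C> A B; g \<in> Mor \<C> B D\<rbrakk>
      \<Longrightarrow> g \<cdot> (f \<otimes>\<^bsub>Hom \<C> A B\<^esub> f') = (g \<cdot> f) \<otimes>\<^bsub>Hom \<C> A D\<^esub> (g \<cdot> f')"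
    and zero_object_exists: "\<exists>Z. is_zero_object \<C> Z"
    and biproduct_exists: "\<lbrakk>A \<in> Obj \<C>; B \<in> Obj \<C>\<rbrakk> \<Longrightarrow> \<exists>P. is_biproduct \<C> A B P"


section \<open>Extriangulated categories\<close>

text \<open>
  \<open>Ext \<C> C A\<close> is the abelian group \<open>\<E>(C, A)\<close>, and \<open>ExtMap \<C> c a\<close> is the map \<open>\<E>(c, a)\<close>,
  contravariant in \<open>c\<close> and covariant in \<open>a\<close>.  A sequence \<open>A \<rightarrow> B \<rightarrow> C\<close> with fixed end terms is a
  triple \<open>(x, B, y)\<close>, and \<open>realization \<C> C A \<delta>\<close> is the equivalence class \<open>\<s>(\<delta>)\<close> of such triples.
\<close>

record ('o, 'a, 'e) extriangulated_data = "('o, 'a) category_data" +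
  Ext :: "'o \<Rightarrow> 'o \<Rightarrow> 'e monoid"
  ExtMap :: "'a \<Rightarrow> 'a \<Rightarrow> 'e \<Rightarrow> 'e"
  realization :: "'o \<Rightarrow> 'o \<Rightarrow> 'e \<Rightarrow> ('a \<times> 'o \<times> 'a) set"

text \<open>\<open>push \<C> C a\<close> is \<open>a\<^sub>* : \<E>(C, A) \<rightarrow> \<E>(C, A')\<close> and \<open>pull \<C> A c\<close> is \<open>c\<^sup>* : \<E>(C, A) \<rightarrow> \<E>(C', A)\<close>.\<close>

definition push :: "('o, 'a, 'e, 'z) extriangulated_data_scheme \<Rightarrow> 'o \<Rightarrow> 'a \<Rightarrow> 'e \<Rightarrow> 'e"
  where "push \<C> C a \<delta> = ExtMap \<C> (Id \<C> C) a \<delta>"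

definition pull :: "('o, 'a, 'e, 'z) extriangulated_data_scheme \<Rightarrow> 'o \<Rightarrow> 'a \<Rightarrow> 'e \<Rightarrow> 'e"
  where "pull \<C> A c \<delta> = ExtMap \<C> c (Id \<C> A) \<delta>"

text \<open>\<open>(a, c)\<close> is a morphism of extensions from \<open>\<delta> \<in> \<E>(C, A)\<close> to \<open>\<delta>' \<in> \<E>(C', A')\<close>.\<close>

definition ext_morphism :: "('o, 'a, 'e, 'z) extriangulated_data_scheme \<Rightarrow>
    'o \<Rightarrow> 'o \<Rightarrow> 'e \<Rightarrow> 'o \<Rightarrow> 'o \<Rightarrow> 'e \<Rightarrow> 'a \<Rightarrow> 'a \<Rightarrow> bool"
  where "ext_morphism \<C> C A \<delta> C' A' \<delta>' a c \<longleftrightarrow>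
    a \<in> Mor \<C> A A' \<and> c \<in> Mor \<C> C C' \<and> push \<C> C a \<delta> = pull \<C> A' c \<delta>'"

definition sequences :: "('o, 'a, 'z) category_data_scheme \<Rightarrow> 'o \<Rightarrow> 'o \<Rightarrow> ('a \<times> 'o \<times> 'a) set"
  where "sequences \<C> A C = {(x, B, y). B \<in> Obj \<C> \<and> x \<in> Mor \<C> A B \<and> y \<in> Mor \<C> B C}"

definition seq_equiv :: "('o, 'a, 'z) category_data_scheme \<Rightarrow> 'o \<Rightarrow> 'o \<Rightarrow>
    (('a \<times> 'o \<times> 'a) \<times> ('a \<times> 'o \<times> 'a)) set"
  where "seq_equiv \<C> A C = {((x, B, y), (x', B', y')).
    (x, B, y) \<in> sequences \<C> A C \<and> (x', B', y') \<in> sequences \<C> A C \<and>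
    (\<exists>b. is_isomorphism \<C> B B' b \<and> b \<cdot>\<^bsub>\<C>\<^esub> x = x' \<and> y' \<cdot>\<^bsub>\<C>\<^esub> b = y)}"

text \<open>\<open>realizes \<C> \<delta> A x B y C\<close> says that \<open>\<delta> \<in> \<E>(C, A)\<close> and \<open>\<s>(\<delta>) = [A \<rightarrow> B \<rightarrow> C]\<close>.\<close>

definition realizes :: "('o, 'a, 'e, 'z) extriangulated_data_scheme \<Rightarrow>
    'e \<Rightarrow> 'o \<Rightarrow> 'a \<Rightarrow> 'o \<Rightarrow> 'a \<Rightarrow> 'o \<Rightarrow> bool"
  where "realizes \<C> \<delta> A x B y C \<longleftrightarrow>
    A \<in> Obj \<C> \<and> C \<in> Obj \<C> \<and> \<delta> \<in> carrier (Ext \<C> C A) \<and> (x, B, y) \<in> sequences \<C> A C \<and>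
    realization \<C> C A \<delta> = seq_equiv \<C> A C `` {(x, B, y)}"

text \<open>
  For \<open>\<delta> \<in> \<E>(C, A)\<close> and \<open>\<delta>' \<in> \<E>(C', A')\<close>, with \<open>P\<close> a biproduct of \<open>C, C'\<close> and \<open>Q\<close> one of \<open>A, A'\<close>,
  the sum \<open>\<delta> \<oplus> \<delta>'\<close> is the element \<open>\<epsilon>\<close> of \<open>\<E>(C \<oplus> C', A \<oplus> A')\<close> with components
  \<open>(\<delta>, 0, 0, \<delta>')\<close>.
\<close>

definition is_ext_sum :: "('o, 'a, 'e, 'z) extriangulated_data_scheme \<Rightarrow>
    ('o, 'a) biproduct_data \<Rightarrow> ('o, 'a) biproduct_data \<Rightarrow>
    'o \<Rightarrow> 'o \<Rightarrow> 'e \<Rightarrow> 'o \<Rightarrow> 'o \<Rightarrow> 'e \<Rightarrow> 'e \<Rightarrow> bool"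
  where "is_ext_sum \<C> P Q C A \<delta> C' A' \<delta>' \<epsilon> \<longleftrightarrow>
    \<epsilon> \<in> carrier (Ext \<C> (apex P) (apex Q)) \<and>
    ExtMap \<C> (in1 P) (pr1 Q) \<epsilon> = \<delta> \<and>
    ExtMap \<C> (in1 P) (pr2 Q) \<epsilon> = \<one>\<^bsub>Ext \<C> C A'\<^esub> \<and>
    ExtMap \<C> (in2 P) (pr1 Q) \<epsilon> = \<one>\<^bsub>Ext \<C> C' A\<^esub> \<and>
    ExtMap \<C> (in2 P) (pr2 Q) \<epsilon> = \<delta>'"

locale additive_ext_bifunctor = additive_category \<C>
  for \<C> :: "('o, 'a, 'e, 'z) extriangulated_data_scheme" (structure) +
  assumes Ext_group: "\<lbrakk>C \<in> Obj \<C>; A \<in> Obj \<C>\<rbrakk> \<Longrightarrow> comm_group (Ext \<C> C A)"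
    and ExtMap_hom: "\<lbrakk>C \<in> Obj \<C>; C' \<in> Obj \<C>; A \<in> Obj \<C>; A' \<in> Obj \<C>;
        c \<in> Mor \<C> C' C; a \<in> Mor \<C> A A'\<rbrakk>
      \<Longrightarrow> ExtMap \<C> c a \<in> hom (Ext \<C> C A) (Ext \<C> C' A')"
    and ExtMap_Id: "\<lbrakk>C \<in> Obj \<C>; A \<in> Obj \<C>; \<delta> \<in> carrier (Ext \<C> C A)\<rbrakk>
      \<Longrightarrow> ExtMap \<C> (Id \<C> C) (Id \<C> A) \<delta> = \<delta>"
    and ExtMap_Comp: "\<lbrakk>C \<in> Obj \<C>; C' \<in> Obj \<C>; C'' \<in> Obj \<C>;
        A \<in> Obj \<C>; A' \<in> Obj \<C>; A'' \<in> Obj \<C>;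
        c \<in> Mor \<C> C' C; c' \<in> Mor \<C> C'' C'; a \<in> Mor \<C> A A'; a' \<in> Mor \<C> A' A'';
        \<delta> \<in> carrier (Ext \<C> C A)\<rbrakk>
      \<Longrightarrow> ExtMap \<C> (c \<cdot> c') (a' \<cdot> a) \<delta> = ExtMap \<C> c' a' (ExtMap \<C> c a \<delta>)"
    and push_add: "\<lbrakk>C \<in> Obj \<C>; A \<in> Obj \<C>; A' \<in> Obj \<C>; a \<in> Mor \<C> A A'; b \<in> Mor \<C> A A';
        \<delta> \<in> carrier (Ext \<C> C A)\<rbrakk>
      \<Longrightarrow> push \<C> C (a \<otimes>\<^bsub>Hom \<C> A A'\<^esub> b) \<delta> = push \<C> C a \<delta> \<otimes>\<^bsub>Ext \<C> C A'\<^esub> push \<C> C b \<delta>"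
    and pull_add: "\<lbrakk>C \<in> Obj \<C>; C' \<in> Obj \<C>; A \<in> Obj \<C>; c \<in> Mor \<C> C' C; d \<in> Mor \<C> C' C;
        \<delta> \<in> carrier (Ext \<C> C A)\<rbrakk>
      \<Longrightarrow> pull \<C> A (c \<otimes>\<^bsub>Hom \<C> C' C\<^esub> d) \<delta> = pull \<C> A c \<delta> \<otimes>\<^bsub>Ext \<C> C' A\<^esub> pull \<C> A d \<delta>"

locale additive_realization = additive_ext_bifunctor +
  assumes realization_class: "\<lbrakk>C \<in> Obj \<C>; A \<in> Obj \<C>; \<delta> \<in> carrier (Ext \<C> C A)\<rbrakk>
      \<Longrightarrow> realization \<C> C A \<delta> \<in> sequences \<C> A C // seq_equiv \<C> A C"
    and realization_morphism: "\<lbrakk>realizes \<C> \<delta> A x B y C; realizes \<C> \<delta>' A' x' B' y' C';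
        ext_morphism \<C> C A \<delta> C' A' \<delta>' a c\<rbrakk>
      \<Longrightarrow> \<exists>b \<in> Mor \<C> B B'. b \<cdot> x = x' \<cdot> a \<and> y' \<cdot> b = c \<cdot> y"
    and realization_zero: "is_biproduct \<C> A C P
      \<Longrightarrow> realizes \<C> \<one>\<^bsub>Ext \<C> C A\<^esub> A (in1 P) (apex P) (pr2 P) C"
    and realization_sum: "\<lbrakk>realizes \<C> \<delta> A x B y C; realizes \<C> \<delta>' A' x' B' y' C';
        is_biproduct \<C> A A' PA; is_biproduct \<C> B B' PB; is_biproduct \<C> C C' PC;
        is_ext_sum \<C> PC PA C A \<delta> C' A' \<delta>' \<epsilon>\<rbrakk>
      \<Longrightarrow> realizes \<C> \<epsilon> (apex PA) (mor_sum \<C> PA PB x x') (apex PB) (mor_sum \<C> PB PC y y') (apex PC)"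

locale extriangulated_category = additive_realization +
  assumes ET3: "\<lbrakk>realizes \<C> \<delta> A x B y C; realizes \<C> \<delta>' A' x' B' y' C';
        a \<in> Mor \<C> A A'; b \<in> Mor \<C> B B'; b \<cdot> x = x' \<cdot> a\<rbrakk>
      \<Longrightarrow> \<exists>c. ext_morphism \<C> C A \<delta> C' A' \<delta>' a c \<and> c \<cdot> y = y' \<cdot> b"
    and ET3_op: "\<lbrakk>realizes \<C> \<delta> A x B y C; realizes \<C> \<delta>' A' x' B' y' C';
        b \<in> Mor \<C> B B'; c \<in> Mor \<C> C C'; c \<cdot> y = y' \<cdot> b\<rbrakk>
      \<Longrightarrow> \<exists>a. ext_morphism \<C> C A \<delta> C' A' \<delta>' a c \<and> b \<cdot> x = x' \<cdot> a"
    and ET4: "\<lbrakk>realizes \<C> \<delta> A f B f' D; realizes \<C> \<delta>' B g C g' F\<rbrakk>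
      \<Longrightarrow> \<exists>E h h' d e \<delta>''.
        d \<in> Mor \<C> D E \<and> e \<in> Mor \<C> E F \<and> realizes \<C> \<delta>'' A h C h' E \<and>
        h = g \<cdot> f \<and> h' \<cdot> g = d \<cdot> f' \<and> e \<cdot> h' = g' \<and>
        realizes \<C> (push \<C> F f' \<delta>') D d E e F \<and>
        pull \<C> A d \<delta>'' = \<delta> \<and>
        push \<C> E f \<delta>'' = pull \<C> B e \<delta>'"
    and ET4_op: "\<lbrakk>realizes \<C> \<delta> D f' A f B; realizes \<C> \<delta>' F g' B g C\<rbrakk>
      \<Longrightarrow> \<exists>E h h' d e \<delta>''.
        d \<in> Mor \<C> D E \<and> e \<in> Mor \<C> E F \<and> realizes \<C> \<delta>'' E h' A h C \<and>
        h = g \<cdot> f \<and> f \<cdot> h' = g' \<cdot> e \<and> h' \<cdot> d = f' \<and>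
        realizes \<C> (pull \<C> D g' \<delta>) D d E e F \<and>
        push \<C> C e \<delta>'' = \<delta>' \<and>
        push \<C> B d \<delta> = pull \<C> E g \<delta>''"

definition conflation :: "('o, 'a, 'e, 'z) extriangulated_data_scheme \<Rightarrow>
    'o \<Rightarrow> 'a \<Rightarrow> 'o \<Rightarrow> 'a \<Rightarrow> 'o \<Rightarrow> bool"
  where "conflation \<C> X x Y y Z \<longleftrightarrow> (\<exists>\<delta>. realizes \<C> \<delta> X x Y y Z)"

definition serre_subcategory ::
    "('o, 'a, 'e, 'z) extriangulated_data_scheme \<Rightarrow> 'o set \<Rightarrow> bool"
  where "serre_subcategory \<C> S \<longleftrightarrow>
    S \<subseteq> Obj \<C> \<and>
    (\<forall>A \<in> S. \<forall>B. (A, B) \<in> iso_rel \<C> \<longrightarrow> B \<in> S) \<and>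
    (\<forall>Z. is_zero_object \<C> Z \<longrightarrow> Z \<in> S) \<and>
    (\<forall>A \<in> S. \<forall>B \<in> S. \<forall>P. is_biproduct \<C> A B P \<longrightarrow> apex P \<in> S) \<and>
    (\<forall>X x Y y Z. conflation \<C> X x Y y Z \<longrightarrow> (Y \<in> S \<longleftrightarrow> X \<in> S \<and> Z \<in> S))"


section \<open>Faces and the Grothendieck monoid\<close>

definition face :: "('m, 'z) monoid_scheme \<Rightarrow> 'm set \<Rightarrow> bool"
  where "face M F \<longleftrightarrow> submonoid F M \<and>
    (\<forall>a \<in> carrier M. \<forall>b \<in> carrier M. a \<otimes>\<^bsub>M\<^esub> b \<in> F \<longleftrightarrow> a \<in> F \<and> b \<in> F)"

definition respects_conflations :: "('o, 'a, 'e, 'z) extriangulated_data_scheme \<Rightarrow>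
    ('m, 'y) monoid_scheme \<Rightarrow> ('o set \<Rightarrow> 'm) \<Rightarrow> bool"
  where "respects_conflations \<C> M f \<longleftrightarrow>
    f \<in> Iso \<C> \<rightarrow> carrier M \<and>
    (\<forall>Z. is_zero_object \<C> Z \<longrightarrow> f (iso_class \<C> Z) = \<one>\<^bsub>M\<^esub>) \<and>
    (\<forall>X x Y y Z. conflation \<C> X x Y y Z \<longrightarrow>
      f (iso_class \<C> Y) = f (iso_class \<C> X) \<otimes>\<^bsub>M\<^esub> f (iso_class \<C> Z))"

text \<open>
  The Grothendieck monoid is constructed as the free commutative monoid on \<open>Iso \<C>\<close> (finite multisets)
  modulo the smallest congruence that makes the generators respect conflations.  The theorem
  \<open>grothendieck_monoid_universal\<close> below is its universal property, for target monoids
  over an arbitrary type.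
\<close>

inductive_set grothendieck_cong ::
    "('o, 'a, 'e, 'z) extriangulated_data_scheme \<Rightarrow> ('o set multiset \<times> 'o set multiset) set"
  for \<C>
  where
    zero: "is_zero_object \<C> Z \<Longrightarrow> ({#iso_class \<C> Z#}, {#}) \<in> grothendieck_cong \<C>"
  | conflation: "conflation \<C> X x Y y Z \<Longrightarrow>
      ({#iso_class \<C> Y#}, {#iso_class \<C> X, iso_class \<C> Z#}) \<in> grothendieck_cong \<C>"
  | refl: "set_mset u \<subseteq> Iso \<C> \<Longrightarrow> (u, u) \<in> grothendieck_cong \<C>"
  | sym: "(u, v) \<in> grothendieck_cong \<C> \<Longrightarrow> (v, u) \<in> grothendieck_cong \<C>"
  | trans: "(u, v) \<in> grothendieck_cong \<C> \<Longrightarrow> (v, w) \<in> grothendieck_cong \<C>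
      \<Longrightarrow> (u, w) \<in> grothendieck_cong \<C>"
  | add: "(u, u') \<in> grothendieck_cong \<C> \<Longrightarrow> (v, v') \<in> grothendieck_cong \<C>
      \<Longrightarrow> (u + v, u' + v') \<in> grothendieck_cong \<C>"

definition grothendieck_monoid ::
    "('o, 'a, 'e, 'z) extriangulated_data_scheme \<Rightarrow> 'o set multiset set monoid"
  where "grothendieck_monoid \<C> =
    \<lparr>carrier = {u. set_mset u \<subseteq> Iso \<C>} // grothendieck_cong \<C>,
     monoid.mult = (\<lambda>U V. grothendieck_cong \<C> `` {u + v | u v. u \<in> U \<and> v \<in> V}),
     one = grothendieck_cong \<C> `` {{#}}\<rparr>"

definition grothendieck_class ::
    "('o, 'a, 'e, 'z) extriangulated_data_scheme \<Rightarrow> 'o set \<Rightarrow> 'o set multiset set"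
  where "grothendieck_class \<C> I = grothendieck_cong \<C> `` {{#I#}}"

lemma iso_class_in_Iso: "A \<in> Obj \<C> \<Longrightarrow> iso_class \<C> A \<in> Iso \<C>"
  by (simp add: Iso_def quotientI)

lemma conflation_objects:
  assumes "conflation \<C> X x Y y Z"
  shows "X \<in> Obj \<C>" "Y \<in> Obj \<C>" "Z \<in> Obj \<C>"
  using assms by (auto simp: conflation_def realizes_def sequences_def)

lemma grothendieck_cong_carrier:
  "(u, v) \<in> grothendieck_cong \<C> \<Longrightarrow> set_mset u \<subseteq> Iso \<C> \<and> set_mset v \<subseteq> Iso \<C>"
  by (induction rule: grothendieck_cong.induct)
    (auto simp: is_zero_object_def dest: conflation_objects intro: iso_class_in_Iso)

lemma equiv_grothendieck_cong: "equiv {u. set_mset u \<subseteq> Iso \<C>} (grothendieck_cong \<C>)"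
  by (rule equivI)
    (auto intro: refl_onI symI transI grothendieck_cong.intros dest: grothendieck_cong_carrier)

lemma grothendieck_mult_class:
  assumes "set_mset u \<subseteq> Iso \<C>" "set_mset v \<subseteq> Iso \<C>"
  shows "(grothendieck_cong \<C> `` {u}) \<otimes>\<^bsub>grothendieck_monoid \<C>\<^esub> (grothendieck_cong \<C> `` {v})
    = grothendieck_cong \<C> `` {u + v}"
  using assms unfolding grothendieck_monoid_def
  by (auto intro: grothendieck_cong.intros)

lemma grothendieck_carrier_cases:
  assumes "U \<in> carrier (grothendieck_monoid \<C>)"
  obtains u where "set_mset u \<subseteq> Iso \<C>" "U = grothendieck_cong \<C> `` {u}"
  using assms by (auto simp: grothendieck_monoid_def elim: quotientE)

lemma grothendieck_class_closed [intro]: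
  "set_mset u \<subseteq> Iso \<C> \<Longrightarrow> grothendieck_cong \<C> `` {u} \<in> carrier (grothendieck_monoid \<C>)"
  by (auto simp: grothendieck_monoid_def intro: quotientI)

lemma grothendieck_one: "\<one>\<^bsub>grothendieck_monoid \<C>\<^esub> = grothendieck_cong \<C> `` {{#}}"
  by (simp add: grothendieck_monoid_def)

theorem grothendieck_monoid_comm_monoid: "comm_monoid (grothendieck_monoid \<C>)"
proof (rule comm_monoidI)
  show "\<one>\<^bsub>grothendieck_monoid \<C>\<^esub> \<in> carrier (grothendieck_monoid \<C>)"
    unfolding grothendieck_one by (rule grothendieck_class_closed) simp
next
  fix U V assume "U \<in> carrier (grothendieck_monoid \<C>)" "V \<in> carrier (grothendieck_monoid \<C>)"
  then show "U \<otimes>\<^bsub>grothendieck_monoid \<C>\<^esub> V \<in> carrier (grothendieck_monoid \<C>)"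
    "U \<otimes>\<^bsub>grothendieck_monoid \<C>\<^esub> V = V \<otimes>\<^bsub>grothendieck_monoid \<C>\<^esub> U"
    by (auto elim!: grothendieck_carrier_cases
        simp: grothendieck_mult_class grothendieck_class_closed add.commute)
next
  fix U V W assume "U \<in> carrier (grothendieck_monoid \<C>)" "V \<in> carrier (grothendieck_monoid \<C>)"
    "W \<in> carrier (grothendieck_monoid \<C>)"
  then show "U \<otimes>\<^bsub>grothendieck_monoid \<C>\<^esub> V \<otimes>\<^bsub>grothendieck_monoid \<C>\<^esub> W
    = U \<otimes>\<^bsub>grothendieck_monoid \<C>\<^esub> (V \<otimes>\<^bsub>grothendieck_monoid \<C>\<^esub> W)"
    by (auto elim!: grothendieck_carrier_cases simp: grothendieck_mult_class add.assoc)
next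
  fix U assume "U \<in> carrier (grothendieck_monoid \<C>)"
  then show "\<one>\<^bsub>grothendieck_monoid \<C>\<^esub> \<otimes>\<^bsub>grothendieck_monoid \<C>\<^esub> U = U"
    by (auto elim!: grothendieck_carrier_cases simp: grothendieck_mult_class grothendieck_one)
qed

lemma grothendieck_class_eq:
  "(u, v) \<in> grothendieck_cong \<C> \<Longrightarrow> grothendieck_cong \<C> `` {u} = grothendieck_cong \<C> `` {v}"
  by (rule equiv_class_eq[OF equiv_grothendieck_cong])

theorem grothendieck_class_respects_conflations:
  "respects_conflations \<C> (grothendieck_monoid \<C>) (grothendieck_class \<C>)"
  unfolding respects_conflations_def
proof (intro conjI allI impI funcsetI)
  fix I assume "I \<in> Iso \<C>"
  then show "grothendieck_class \<C> I \<in> carrier (grothendieck_monoid \<C>)"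
    by (auto simp: grothendieck_class_def)
next
  fix Z assume "is_zero_object \<C> Z"
  then show "grothendieck_class \<C> (iso_class \<C> Z) = \<one>\<^bsub>grothendieck_monoid \<C>\<^esub>"
    unfolding grothendieck_class_def grothendieck_one
    by (intro grothendieck_class_eq grothendieck_cong.zero)
next
  fix X x Y y Z assume c: "conflation \<C> X x Y y Z"
  have "grothendieck_class \<C> (iso_class \<C> X) \<otimes>\<^bsub>grothendieck_monoid \<C>\<^esub>
      grothendieck_class \<C> (iso_class \<C> Z)
    = grothendieck_cong \<C> `` {{#iso_class \<C> X#} + {#iso_class \<C> Z#}}"
    unfolding grothendieck_class_def
    by (rule grothendieck_mult_class) (simp_all add: iso_class_in_Iso conflation_objects[OF c])
  also have "\<dots> = grothendieck_class \<C> (iso_class \<C> Y)"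
    using grothendieck_class_eq[OF grothendieck_cong.conflation[OF c]]
    by (simp add: grothendieck_class_def add_mset_commute)
  finally show "grothendieck_class \<C> (iso_class \<C> Y) = grothendieck_class \<C> (iso_class \<C> X)
    \<otimes>\<^bsub>grothendieck_monoid \<C>\<^esub> grothendieck_class \<C> (iso_class \<C> Z)" by simp
qed

text \<open>
  A map respecting conflations extends to multisets by iterated addition; the extension is
  compatible with the congruence.  The guards make the folded function left-commutative on all of
  the type; they hold whenever \<open>f\<close> maps into the carrier.
\<close>

definition mset_extension :: "('m, 'y) monoid_scheme \<Rightarrow> ('i \<Rightarrow> 'm) \<Rightarrow> 'i multiset \<Rightarrow> 'm"
  where "mset_extension N f u = fold_mset
    (\<lambda>i n. if f i \<in> carrier N \<and> n \<in> carrier N then f i \<otimes>\<^bsub>N\<^esub> n else n) \<one>\<^bsub>N\<^esub> u"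

lemma mset_extension_empty: "mset_extension N f {#} = \<one>\<^bsub>N\<^esub>"
  by (simp add: mset_extension_def)

context comm_monoid
begin

lemma mset_extension_add_mset_aux:
  "mset_extension G f (add_mset i u) =
    (if f i \<in> carrier G \<and> mset_extension G f u \<in> carrier G
     then f i \<otimes> mset_extension G f u else mset_extension G f u)"
proof -
  interpret comp_fun_commute
    "\<lambda>i n. if f i \<in> carrier G \<and> n \<in> carrier G then f i \<otimes> n else n"
    by unfold_locales (auto simp: fun_eq_iff m_lcomm)
  show ?thesis by (simp add: mset_extension_def)
qed

lemma mset_extension_closed: "mset_extension G f u \<in> carrier G"
  by (induction u) (simp_all add: mset_extension_empty mset_extension_add_mset_aux)

lemma mset_extension_add_mset:
  "f i \<in> carrier G \<Longrightarrow> mset_extension G f (add_mset i u) = f i \<otimes> mset_extension G f u"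
  by (simp add: mset_extension_add_mset_aux mset_extension_closed)

lemma mset_extension_union:
  "f ` set_mset u \<subseteq> carrier G
    \<Longrightarrow> mset_extension G f (u + v) = mset_extension G f u \<otimes> mset_extension G f v"
  by (induction u)
    (simp_all add: mset_extension_empty mset_extension_add_mset mset_extension_closed m_assoc)

lemma mset_extension_cong:
  assumes f: "respects_conflations \<C> G f" and uv: "(u, v) \<in> grothendieck_cong \<C>"
  shows "mset_extension G f u = mset_extension G f v"
  using uv
proof (induction rule: grothendieck_cong.induct)
  case (zero Z)
  then have "f (iso_class \<C> Z) = \<one>" using f by (simp add: respects_conflations_def)
  then show ?case by (simp add: mset_extension_add_mset mset_extension_empty)
next
  case (conflation X x Y y Z)
  have *: "f (iso_class \<C> X) \<in> carrier G" "f (iso_class \<C> Y) \<in> carrier G"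
    "f (iso_class \<C> Z) \<in> carrier G"
    using f conflation_objects[OF conflation] by (auto simp: respects_conflations_def iso_class_in_Iso)
  moreover have "f (iso_class \<C> Y) = f (iso_class \<C> X) \<otimes> f (iso_class \<C> Z)"
    using f conflation unfolding respects_conflations_def by blast
  ultimately show ?case by (simp add: mset_extension_add_mset mset_extension_empty)
next
  case (add u u' v v')
  have "f ` set_mset w \<subseteq> carrier G" if "set_mset w \<subseteq> Iso \<C>" for w
    using f that by (auto simp: respects_conflations_def)
  then show ?case
    using add grothendieck_cong_carrier[OF add.hyps(1)] by (simp add: mset_extension_union)
qed simp_all

end

theorem grothendieck_monoid_universal:
  fixes N :: "('n, 'y) monoid_scheme"
  assumes N: "comm_monoid N" and f: "respects_conflations \<C> N f"
  shows "\<exists>!\<phi>. \<phi> \<in> extensional (carrier (grothendieck_monoid \<C>)) \<and>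
    \<phi> \<in> hom (grothendieck_monoid \<C>) N \<and> \<phi> \<one>\<^bsub>grothendieck_monoid \<C>\<^esub> = \<one>\<^bsub>N\<^esub> \<and>
    (\<forall>I \<in> Iso \<C>. \<phi> (grothendieck_class \<C> I) = f I)"
proof -
  interpret comm_monoid N by fact
  let ?M = "grothendieck_monoid \<C>" and ?R = "grothendieck_cong \<C>"
  have fc: "f ` set_mset u \<subseteq> carrier N" if "set_mset u \<subseteq> Iso \<C>" for u
    using f that by (auto simp: respects_conflations_def)
  define \<phi> where "\<phi> = restrict (\<lambda>U. mset_extension N f (SOME u. u \<in> U)) (carrier ?M)"
  have val: "\<phi> (?R `` {u}) = mset_extension N f u" if u: "set_mset u \<subseteq> Iso \<C>" for u
  proof -
    have "u \<in> ?R `` {u}" using u by (auto intro: grothendieck_cong.refl)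
    then have "(SOME u'. u' \<in> ?R `` {u}) \<in> ?R `` {u}" by (rule someI)
    then have "mset_extension N f u = mset_extension N f (SOME u'. u' \<in> ?R `` {u})"
      by (intro mset_extension_cong[OF f]) simp
    then show ?thesis using grothendieck_class_closed[OF u] by (simp add: \<phi>_def)
  qed
  show ?thesis
  proof (rule ex1I[of _ \<phi>], intro conjI ballI)
    show "\<phi> \<in> extensional (carrier ?M)" by (simp add: \<phi>_def)
    show "\<phi> \<in> hom ?M N"
    proof (rule homI)
      fix U V assume "U \<in> carrier ?M" "V \<in> carrier ?M"
      then show "\<phi> (U \<otimes>\<^bsub>?M\<^esub> V) = \<phi> U \<otimes>\<^bsub>N\<^esub> \<phi> V"
        by (auto elim!: grothendieck_carrier_cases
            simp: grothendieck_mult_class val mset_extension_union fc)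
    qed (auto elim!: grothendieck_carrier_cases simp: val mset_extension_closed)
    show "\<phi> \<one>\<^bsub>?M\<^esub> = \<one>\<^bsub>N\<^esub>"
      by (simp add: grothendieck_one val mset_extension_empty)
    show "\<phi> (grothendieck_class \<C> I) = f I" if "I \<in> Iso \<C>" for I
      using fc[of "{#I#}"] that
      by (simp add: grothendieck_class_def val mset_extension_add_mset mset_extension_empty)
  next
    fix \<psi>
    assume \<psi>: "\<psi> \<in> extensional (carrier ?M) \<and> \<psi> \<in> hom ?M N \<and> \<psi> \<one>\<^bsub>?M\<^esub> = \<one>\<^bsub>N\<^esub> \<and>
      (\<forall>I \<in> Iso \<C>. \<psi> (grothendieck_class \<C> I) = f I)"
    have "\<psi> (?R `` {u}) = mset_extension N f u" if "set_mset u \<subseteq> Iso \<C>" for u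
      using that
    proof (induction u)
      case empty
      then show ?case using \<psi> by (simp add: grothendieck_one mset_extension_empty)
    next
      case (add I u)
      then have "?R `` {add_mset I u} = grothendieck_class \<C> I \<otimes>\<^bsub>?M\<^esub> (?R `` {u})"
        unfolding grothendieck_class_def by (subst grothendieck_mult_class) simp_all
      moreover have "grothendieck_class \<C> I \<in> carrier ?M" "?R `` {u} \<in> carrier ?M"
        using add.prems by (auto simp: grothendieck_class_def)
      moreover have "\<psi> (U \<otimes>\<^bsub>?M\<^esub> V) = \<psi> U \<otimes>\<^bsub>N\<^esub> \<psi> V"
        if "U \<in> carrier ?M" "V \<in> carrier ?M" for U V
        using \<psi> that by (auto simp: hom_def)
      ultimately show ?case
        using \<psi> add fc[of "{#I#}"] by (simp add: mset_extension_add_mset)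
    qed
    then have "\<psi> U = \<phi> U" if "U \<in> carrier ?M" for U
      using that by (auto elim!: grothendieck_carrier_cases simp: val)
    moreover have "\<phi> \<in> extensional (carrier ?M)" by (simp add: \<phi>_def)
    ultimately show "\<psi> = \<phi>"
      using \<psi> by (intro extensionalityI[of \<psi> "carrier ?M" \<phi>]) simp_all
  qed
qed

end

(*
  A Serre subcategory S corresponds to the set of sums of classes of objects of S.  The point is
  that "all summands lie in S" is invariant under each defining relation of the Grothendieck
  congruence, so it depends only on the element of the monoid and S can be recovered from the
  classes [X] it contains.  Conversely, a sum lies in a face iff all its summands do, so a face is
  determined by the generators [X] it contains.
*)

theory Submission
  imports Defs
begin

lemma (in category) equiv_iso_rel: "equiv (Obj \<C>) (iso_rel \<C>)"
proof (rule equivI)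
  show "iso_rel \<C> \<subseteq> Obj \<C> \<times> Obj \<C>" by (auto simp: iso_rel_def)
  have "is_isomorphism \<C> A A (Id \<C> A)" if "A \<in> Obj \<C>" for A
    unfolding is_isomorphism_def using that by (auto intro!: bexI[of _ "Id \<C> A"] Id_Mor Id_Comp)
  then show "refl_on (Obj \<C>) (iso_rel \<C>)"
    by (auto simp: refl_on_def iso_rel_def)
  show "sym (iso_rel \<C>)"
    unfolding sym_def iso_rel_def is_isomorphism_def by blast
  show "trans (iso_rel \<C>)"
  proof (rule transI)
    fix A B D
    assume "(A, B) \<in> iso_rel \<C>" "(B, D) \<in> iso_rel \<C>"
    then obtain f f' g g' where obj: "A \<in> Obj \<C>" "B \<in> Obj \<C>" "D \<in> Obj \<C>"
      and f: "f \<in> Mor \<C> A B" "f' \<in> Mor \<C> B A" "f' \<cdot> f = Id \<C> A" "f \<cdot> f' = Id \<C> B"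
      and g: "g \<in> Mor \<C> B D" "g' \<in> Mor \<C> D B" "g' \<cdot> g = Id \<C> B" "g \<cdot> g' = Id \<C> D"
      unfolding iso_rel_def is_isomorphism_def by auto
    \<comment> \<open>A one-sided inverse of a composite, stated once in general: it serves both
      \<open>(f' \<cdot> g') \<cdot> (g \<cdot> f) = Id \<C> A\<close> and, with the roles of the
      isomorphisms and their inverses exchanged,
      \<open>(g \<cdot> f) \<cdot> (f' \<cdot> g') = Id \<C> D\<close>.\<close>
    have cancel: "(k' \<cdot> h') \<cdot> (h \<cdot> k) = Id \<C> X"
      if "X \<in> Obj \<C>" "Y \<in> Obj \<C>" "Z \<in> Obj \<C>" "k \<in> Mor \<C> X Y" "k' \<in> Mor \<C> Y X"
        "h \<in> Mor \<C> Y Z" "h' \<in> Mor \<C> Z Y" "k' \<cdot> k = Id \<C> X" "h' \<cdot> h = Id \<C> Y"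
      for X Y Z h h' k k'
    proof -
      have "(k' \<cdot> h') \<cdot> (h \<cdot> k) = k' \<cdot> (h' \<cdot> (h \<cdot> k))"
        using that by (intro Comp_assoc[of X Z Y X]) (auto intro: Comp_Mor)
      also have "h' \<cdot> (h \<cdot> k) = (h' \<cdot> h) \<cdot> k"
        using that by (intro Comp_assoc[of X Y Z Y, symmetric])
      finally show ?thesis using that by (simp add: Id_Comp[of X Y])
    qed
    have "is_isomorphism \<C> A D (g \<cdot> f)"
      unfolding is_isomorphism_def
      using obj f g cancel[of A B D f f' g g'] cancel[of D B A g' g f' f]
      by (auto intro!: bexI[of _ "f' \<cdot> g'"] Comp_Mor[of _ B])
    then show "(A, D) \<in> iso_rel \<C>" using obj by (auto simp: iso_rel_def)
  qed
qed

text \<open>Closure under isomorphism makes an isomorphism class lie in \<open>S\<close> as soon as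
  one of its objects does. This translates between the generators of the monoid, which are classes,
  and the objects of \<open>S\<close>.\<close>

lemma serre_iso_class_subset_iff:
  assumes "category \<C>" "serre_subcategory \<C> S" "A \<in> Obj \<C>"
  shows "iso_class \<C> A \<subseteq> S \<longleftrightarrow> A \<in> S"
proof
  show "A \<in> S" if "iso_class \<C> A \<subseteq> S"
    using that equiv_class_self[OF category.equiv_iso_rel[OF assms(1)] assms(3)] by (rule subsetD)
  have "B \<in> S" if "A \<in> S" "(A, B) \<in> iso_rel \<C>" for B
    using assms(2) that unfolding serre_subcategory_def by blast
  then show "iso_class \<C> A \<subseteq> S" if "A \<in> S" using that by auto
qed

text \<open>Induction on the congruence. A zero object lies in \<open>S\<close>, and the Serre
  condition is exactly invariance under the relation of a conflation; the closure rules preserve the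
  equivalence formally.\<close>

lemma serre_grothendieck_cong_iff:
  assumes "category \<C>" "serre_subcategory \<C> S" "(u, v) \<in> grothendieck_cong \<C>"
  shows "(\<forall>I \<in># u. I \<subseteq> S) \<longleftrightarrow> (\<forall>I \<in># v. I \<subseteq> S)"
  using assms(3)
proof (induction rule: grothendieck_cong.induct)
  case (zero Z)
  then have "Z \<in> Obj \<C>" "Z \<in> S"
    using assms(2) by (auto simp: is_zero_object_def serre_subcategory_def)
  then show ?case using serre_iso_class_subset_iff[OF assms(1,2)] by simp
next
  case (conflation X x Y y Z)
  have "Y \<in> S \<longleftrightarrow> X \<in> S \<and> Z \<in> S"
    using assms(2) conflation unfolding serre_subcategory_def by blast
  then show ?case
    using serre_iso_class_subset_iff[OF assms(1,2)] conflation_objects[OF conflation] by simp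
qed auto

text \<open>For a Serre subcategory this is the submonoid generated by the classes [X] with X in
  \<open>S\<close>. The letters of \<open>u\<close> are isomorphism classes rather than objects,
  hence the condition \<open>I \<subseteq> S\<close>.\<close>

definition serre_face ::
    "('o, 'a, 'e, 'z) extriangulated_data_scheme \<Rightarrow> 'o set \<Rightarrow> 'o set multiset set set"
  where "serre_face \<C> S =
    {grothendieck_cong \<C> `` {u} | u. set_mset u \<subseteq> Iso \<C> \<and> (\<forall>I \<in># u. I \<subseteq> S)}"

definition face_objects ::
    "('o, 'a, 'e, 'z) extriangulated_data_scheme \<Rightarrow> 'o set multiset set set \<Rightarrow> 'o set"
  where "face_objects \<C> F = {A \<in> Obj \<C>. grothendieck_class \<C> (iso_class \<C> A) \<in> F}"

text \<open>The definition of \<open>serre_face\<close> only asks for some good representative; by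
  invariance under the congruence, every representative is then good, so membership can be tested on
  any given \<open>u\<close>.\<close>

lemma grothendieck_cong_class_in_serre_face_iff:
  assumes "category \<C>" "serre_subcategory \<C> S" "set_mset u \<subseteq> Iso \<C>"
  shows "grothendieck_cong \<C> `` {u} \<in> serre_face \<C> S \<longleftrightarrow> (\<forall>I \<in># u. I \<subseteq> S)"
proof
  assume "grothendieck_cong \<C> `` {u} \<in> serre_face \<C> S"
  then obtain v where v: "grothendieck_cong \<C> `` {u} = grothendieck_cong \<C> `` {v}"
    "set_mset v \<subseteq> Iso \<C>" "\<forall>I \<in># v. I \<subseteq> S"
    by (auto simp: serre_face_def)
  then have "(u, v) \<in> grothendieck_cong \<C>"
    using eq_equiv_class[OF _ equiv_grothendieck_cong] by blast
  then show "\<forall>I \<in># u. I \<subseteq> S"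
    using serre_grothendieck_cong_iff[OF assms(1,2)] v by blast
qed (use assms in \<open>auto simp: serre_face_def\<close>)

text \<open>Addition in the monoid is union of representing multisets, and a condition on all
  letters holds for \<open>u + v\<close> iff it holds for both \<open>u\<close> and
  \<open>v\<close>. This gives both directions of the face condition at once.\<close>

lemma face_serre_face:
  assumes "category \<C>" "serre_subcategory \<C> S"
  shows "face (grothendieck_monoid \<C>) (serre_face \<C> S)"
proof -
  let ?M = "grothendieck_monoid \<C>"
  have mult: "U \<otimes>\<^bsub>?M\<^esub> V \<in> serre_face \<C> S \<longleftrightarrow> U \<in> serre_face \<C> S \<and> V \<in> serre_face \<C> S"
    if UV: "U \<in> carrier ?M" "V \<in> carrier ?M" for U V
  proof -
    obtain u v where "set_mset u \<subseteq> Iso \<C>" "U = grothendieck_cong \<C> `` {u}"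
      "set_mset v \<subseteq> Iso \<C>" "V = grothendieck_cong \<C> `` {v}"
      using UV by (meson grothendieck_carrier_cases)
    then show ?thesis
      by (simp add: grothendieck_mult_class grothendieck_cong_class_in_serre_face_iff[OF assms]
          ball_Un)
  qed
  moreover have sub: "serre_face \<C> S \<subseteq> carrier ?M"
    by (auto simp: serre_face_def)
  moreover have "\<one>\<^bsub>?M\<^esub> \<in> serre_face \<C> S"
    by (simp add: grothendieck_one grothendieck_cong_class_in_serre_face_iff[OF assms])
  ultimately show ?thesis
    unfolding face_def by (auto intro!: submonoid.intro)
qed

text \<open>The element [A] is represented by a one-letter multiset, so the membership test reduces
  to \<open>iso_class \<C> A \<subseteq> S\<close>.\<close>

lemma face_objects_serre_face:
  assumes "category \<C>" "serre_subcategory \<C> S"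
  shows "face_objects \<C> (serre_face \<C> S) = S"
proof -
  have "grothendieck_class \<C> (iso_class \<C> A) \<in> serre_face \<C> S \<longleftrightarrow> A \<in> S" if "A \<in> Obj \<C>" for A
    using that
    by (simp add: grothendieck_class_def grothendieck_cong_class_in_serre_face_iff[OF assms]
        iso_class_in_Iso serre_iso_class_subset_iff[OF assms])
  then show ?thesis using assms(2) by (auto simp: face_objects_def serre_subcategory_def)
qed

text \<open>Since [Y] = [X] + [Z] for a conflation, the face condition at [X] and [Z] becomes the
  Serre condition.\<close>

lemma serre_face_objects:
  assumes "extriangulated_category \<C>" and F: "face (grothendieck_monoid \<C>) F"
  shows "serre_subcategory \<C> (face_objects \<C> F)"
proof -
  interpret extriangulated_category \<C> by fact
  let ?M = "grothendieck_monoid \<C>" and ?c = "\<lambda>A. grothendieck_class \<C> (iso_class \<C> A)"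
  note resp = grothendieck_class_respects_conflations[of \<C>, unfolded respects_conflations_def]
  have closed: "?c A \<in> carrier ?M" if "A \<in> Obj \<C>" for A
    using resp iso_class_in_Iso[OF that] by blast
  have confl: "Y \<in> face_objects \<C> F \<longleftrightarrow> X \<in> face_objects \<C> F \<and> Z \<in> face_objects \<C> F"
    if c: "conflation \<C> X x Y y Z" for X x Y y Z
  proof -
    have "?c Y = ?c X \<otimes>\<^bsub>?M\<^esub> ?c Z" using resp c by blast
    then show ?thesis
      using F closed conflation_objects[OF c] by (simp add: face_def face_objects_def)
  qed
  \<comment> \<open>A biproduct is the middle term of the split conflation, which realizes the zero
    extension.\<close>
  have "apex P \<in> face_objects \<C> F"
    if "A \<in> face_objects \<C> F" "B \<in> face_objects \<C> F" "is_biproduct \<C> A B P" for A B P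
    using confl that realization_zero[OF that(3)] unfolding conflation_def by blast
  moreover have "B \<in> face_objects \<C> F"
    if "A \<in> face_objects \<C> F" "(A, B) \<in> iso_rel \<C>" for A B
    using that equiv_class_eq[OF equiv_iso_rel that(2)]
    by (auto simp: face_objects_def iso_rel_def)
  moreover have "Z \<in> face_objects \<C> F" if "is_zero_object \<C> Z" for Z
  proof -
    have "?c Z = \<one>\<^bsub>?M\<^esub>" using resp that by blast
    then show ?thesis
      using F that by (simp add: face_def face_objects_def is_zero_object_def submonoid.one_closed)
  qed
  moreover have "face_objects \<C> F \<subseteq> Obj \<C>" by (auto simp: face_objects_def)
  ultimately show ?thesis
    unfolding serre_subcategory_def using confl by blast
qed

text \<open>The face condition splits off one generator at a time; the empty multiset represents the
  unit, which lies in every face.\<close>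

lemma grothendieck_cong_class_in_face_iff:
  assumes F: "face (grothendieck_monoid \<C>) F" and "set_mset u \<subseteq> Iso \<C>"
  shows "grothendieck_cong \<C> `` {u} \<in> F \<longleftrightarrow> (\<forall>I \<in># u. grothendieck_class \<C> I \<in> F)"
  using assms(2)
proof (induction u)
  case empty
  then show ?case
    using F by (simp add: face_def submonoid.one_closed flip: grothendieck_one)
next
  case (add I u)
  have "grothendieck_cong \<C> `` {add_mset I u} =
      grothendieck_class \<C> I \<otimes>\<^bsub>grothendieck_monoid \<C>\<^esub> (grothendieck_cong \<C> `` {u})"
    unfolding grothendieck_class_def using add.prems by (subst grothendieck_mult_class) simp_all
  moreover have "grothendieck_class \<C> I \<in> carrier (grothendieck_monoid \<C>)"
    "grothendieck_cong \<C> `` {u} \<in> carrier (grothendieck_monoid \<C>)"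
    using add.prems by (auto simp: grothendieck_class_def)
  ultimately show ?case using F add by (simp add: face_def)
qed

text \<open>Both sides are described by the same condition on representatives: each letter of the
  multiset has its class in \<open>F\<close>.\<close>

lemma serre_face_face_objects:
  assumes C: "category \<C>" and F: "face (grothendieck_monoid \<C>) F"
  shows "serre_face \<C> (face_objects \<C> F) = F"
proof -
  have "I \<subseteq> face_objects \<C> F \<longleftrightarrow> grothendieck_class \<C> I \<in> F" if I: "I \<in> Iso \<C>" for I
  proof -
    obtain A where A: "A \<in> Obj \<C>" "I = iso_class \<C> A"
      using I by (auto simp: Iso_def elim: quotientE)
    have "B \<in> face_objects \<C> F \<longleftrightarrow> grothendieck_class \<C> I \<in> F" if "B \<in> I" for B
    proof -
      have "(A, B) \<in> iso_rel \<C>" using that A by simp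
      then have "B \<in> Obj \<C>" "iso_class \<C> B = I"
        using A equiv_class_eq[OF category.equiv_iso_rel[OF C]] by (auto simp: iso_rel_def)
      then show ?thesis by (simp add: face_objects_def)
    qed
    \<comment> \<open>All objects of \<open>I\<close> give the same element of the monoid; that
      \<open>I\<close> is nonempty is what lets \<open>I \<subseteq> face_objects \<C> F\<close>
      imply that this element lies in \<open>F\<close>.\<close>
    moreover have "A \<in> I"
      using A equiv_class_self[OF category.equiv_iso_rel[OF C]] by blast
    ultimately show ?thesis by blast
  qed
  then have *: "(\<forall>I \<in># u. I \<subseteq> face_objects \<C> F) \<longleftrightarrow> grothendieck_cong \<C> `` {u} \<in> F"
    if "set_mset u \<subseteq> Iso \<C>" for u
    using that grothendieck_cong_class_in_face_iff[OF F that] by blast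
  show ?thesis
  proof (intro equalityI subsetI)
    fix U assume "U \<in> F"
    then have "U \<in> carrier (grothendieck_monoid \<C>)"
      using F by (auto simp: face_def submonoid_def)
    then obtain u where "set_mset u \<subseteq> Iso \<C>" "U = grothendieck_cong \<C> `` {u}"
      by (rule grothendieck_carrier_cases)
    with *[of u] \<open>U \<in> F\<close> show "U \<in> serre_face \<C> (face_objects \<C> F)"
      by (auto simp only: serre_face_def)
  qed (use * in \<open>auto simp only: serre_face_def\<close>)
qed

theorem theorem1:
  fixes \<C> :: "('o, 'a, 'e) extriangulated_data"
  assumes "extriangulated_category \<C>"
  shows "\<exists>\<Phi>. bij_betw \<Phi> {S. serre_subcategory \<C> S} {F. face (grothendieck_monoid \<C>) F}"
\<comment> \<open>The bijection sends \<open>S\<close> to the submonoid generated by its classes;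
  its inverse sends \<open>F\<close> to the objects whose class lies in \<open>F\<close>.\<close>
proof (rule exI, rule bij_betw_byWitness[where f = "serre_face \<C>" and f' = "face_objects \<C>"])
  interpret extriangulated_category \<C> by fact
  have C: "category \<C>" ..
  show "\<forall>S \<in> {S. serre_subcategory \<C> S}. face_objects \<C> (serre_face \<C> S) = S"
    using face_objects_serre_face[OF C] by simp
  show "\<forall>F \<in> {F. face (grothendieck_monoid \<C>) F}. serre_face \<C> (face_objects \<C> F) = F"
    using serre_face_face_objects[OF C] by simp
  show "serre_face \<C> ` {S. serre_subcategory \<C> S} \<subseteq> {F. face (grothendieck_monoid \<C>) F}"
    using face_serre_face[OF C] by auto
  show "face_objects \<C> ` {F. face (grothendieck_monoid \<C>) F} \<subseteq> {S. serre_subcategory \<C> S}"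
    using serre_face_objects[OF assms] by auto
qed

end
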